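(* Let $a<-1$ and $f(x,y)=\left(y\frac{x+a}{x-1},x+a-1\right)$ on $\overline{\mathbf R^2}$. Every finite periodic point of $f$ is of saddle type: if $p\in\mathbf R^2$, $n\ge1$, $p\notin I(f^n)$ and $f^n(p)=p$, then $Df^n_p$ has one eigenvalue of modulus $>1$ and one of modulus $<1$.
   Context: Fix a real number $a<-1$. Let $\overline{\mathbf R^2}=(\mathbf R\cup\{\infty\})\times(\mathbf R\cup\{\infty\})$. The birational map $f(x,y)=\left(y\frac{x+a}{x-1},x+a-1\right)$ extends continuously to $\overline{\mathbf R^2}\setminus I(f)$, $I(f)=\{(1,0),(-a,\infty)\}$. $I(f^n)$ denotes the set of points of indeterminacy of $f^n$, $I(f^n)=I(f)\cup f^{-1}I(f)\cup\dots\cup f^{-n+1}I(f)$. "Finite" means lying in $\mathbf R^2$. *)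

theory Defs
  imports "HOL-Analysis.Analysis" "Jordan_Normal_Form.Char_Poly"
begin

section \<open>The compactification\<close>

text \<open>\<open>R \<union> {\<infinity>}\<close> is the one-point compactification of the real line, with \<open>None\<close> as the
  point at infinity; the compactified plane is its square with the product topology.\<close>

type_synonym rline = "real option"

abbreviation rline_top :: "rline topology"
  where "rline_top \<equiv> Alexandroff_compactification euclideanreal"

abbreviation rplane_top :: "(rline \<times> rline) topology"
  where "rplane_top \<equiv> prod_topology rline_top rline_top"

definition emb :: "real \<times> real \<Rightarrow> rline \<times> rline"
  where "emb z = (Some (fst z), Some (snd z))"

text \<open>Inverse of \<^const>\<open>emb\<close> on the finite points; unspecified at infinite points.\<close>

definition fin_part :: "rline \<times> rline \<Rightarrow> real \<times> real"
  where "fin_part w = (the (fst w), the (snd w))"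

section \<open>The birational map and its extension\<close>

definition fmap :: "real \<Rightarrow> real \<times> real \<Rightarrow> real \<times> real"
  where "fmap a z = (let (x, y) = z in (y * ((x + a) / (x - 1)), x + a - 1))"

definition indet :: "real \<Rightarrow> (rline \<times> rline) set"
  where "indet a = {(Some 1, Some 0), (Some (- a), None)}"

text \<open>Multiplication on \<open>R \<union> {\<infinity>}\<close>. The undefined products \<open>0 \<cdot> \<infinity>\<close> and \<open>\<infinity> \<cdot> 0\<close> get the
  arbitrary value \<open>\<infinity>\<close>.\<close>

definition rmult :: "rline \<Rightarrow> rline \<Rightarrow> rline"
  where "rmult u v = (case (u, v) of (Some s, Some t) \<Rightarrow> Some (s * t) | _ \<Rightarrow> None)"

text \<open>The Moebius map \<open>x \<mapsto> (x + a) / (x - 1)\<close> on \<open>R \<union> {\<infinity>}\<close> (for \<open>a \<noteq> -1\<close>).\<close>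

definition rmoeb :: "real \<Rightarrow> rline \<Rightarrow> rline"
  where "rmoeb a u = (case u of None \<Rightarrow> Some 1
     | Some x \<Rightarrow> if x = 1 then None else Some ((x + a) / (x - 1)))"

text \<open>The extension of \<^const>\<open>fmap\<close>. Its values on \<^term>\<open>indet a\<close>, where an undefined
  product occurs, are arbitrary. It agrees with \<^const>\<open>fmap\<close> at the finite points with
  \<open>x \<noteq> 1\<close> (\<open>fbar_extends\<close>) and is continuous off \<^term>\<open>indet a\<close>
  (\<open>continuous_map_fbar\<close>).\<close>

definition fbar :: "real \<Rightarrow> rline \<times> rline \<Rightarrow> rline \<times> rline"
  where "fbar a w = (rmult (snd w) (rmoeb a (fst w)), map_option (\<lambda>x. x + a - 1) (fst w))"

text \<open>The set \<open>I(f\<^sup>n) = I(f) \<union> f\<^sup>-\<^sup>1 I(f) \<union> \<dots> \<union> f\<^sup>-\<^sup>n\<^sup>+\<^sup>1 I(f)\<close>. A point whose orbit enters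
  \<^term>\<open>indet a\<close> belongs to it from that moment on, so the arbitrary values of \<^const>\<open>fbar\<close>
  on \<^term>\<open>indet a\<close> do not influence this set (see \<open>indet_iter_cong\<close>), nor the value of
  the iterates outside it.\<close>

definition indet_iter :: "real \<Rightarrow> nat \<Rightarrow> (rline \<times> rline) set"
  where "indet_iter a n = (\<Union>j<n. (fbar a ^^ j) -` indet a)"

section \<open>Saddle points\<close>

text \<open>The matrix of \<open>D\<close> in the standard basis, with complex entries so that its
  eigenvalues are taken in the complex numbers.\<close>

definition jacobian_mat :: "(real \<times> real \<Rightarrow> real \<times> real) \<Rightarrow> complex mat"
  where "jacobian_mat D = mat_of_rows_list 2
     [[of_real (fst (D (1, 0))), of_real (fst (D (0, 1)))],
      [of_real (snd (D (1, 0))), of_real (snd (D (0, 1)))]]"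

definition saddle_deriv_at :: "(real \<times> real \<Rightarrow> real \<times> real) \<Rightarrow> real \<times> real \<Rightarrow> bool"
  where "saddle_deriv_at g p \<longleftrightarrow>
    (\<exists>D. (g has_derivative D) (at p) \<and>
         (\<exists>l m. eigenvalue (jacobian_mat D) l \<and> eigenvalue (jacobian_mat D) m \<and>
                cmod l > 1 \<and> cmod m < 1))"

section \<open>The extension is the continuous one\<close>

lemma fbar_extends:
  assumes "fst z \<noteq> 1"
  shows "fbar a (emb z) = emb (fmap a z)"
  using assms by (simp add: fbar_def emb_def fmap_def rmult_def rmoeb_def split: prod.split)

lemma insert_None_range_Some [simp]: "insert None (range Some) = UNIV"
  by (rule UNIV_option_conv[symmetric])

lemma topspace_rline: "topspace rline_top = UNIV"
  by simp

lemma openin_rline: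
  "openin rline_top V \<longleftrightarrow> open (Some -` V) \<and> (None \<in> V \<longrightarrow> compact (- (Some -` V)))"
proof
  assume "openin rline_top V"
  then consider U where "open U" "V = Some ` U"
    | C where "compact C" "V = insert None (Some ` (- C))"
    by (auto simp: openin_Alexandroff_compactification Compl_eq_Diff_UNIV)
  then show "open (Some -` V) \<and> (None \<in> V \<longrightarrow> compact (- (Some -` V)))"
  proof cases
    case 1
    then have "Some -` V = U" by auto
    with 1 show ?thesis by auto
  next
    case 2
    then have "Some -` V = - C" by auto
    with 2 show ?thesis by (auto simp: compact_imp_closed open_Compl)
  qed
next
  assume R: "open (Some -` V) \<and> (None \<in> V \<longrightarrow> compact (- (Some -` V)))"
  show "openin rline_top V"
  proof (cases "None \<in> V")
    case True
    have "V = insert None (Some ` (topspace euclideanreal - - (Some -` V)))"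
    proof (intro Set.set_eqI)
      fix u show "u \<in> V \<longleftrightarrow> u \<in> insert None (Some ` (topspace euclideanreal - - (Some -` V)))"
        using True by (cases u) auto
    qed
    moreover have "compact (- (Some -` V))" using R True by blast
    ultimately show ?thesis
      unfolding openin_Alexandroff_compactification
      by (intro disjI2 exI[of _ "- (Some -` V)"]) (simp add: compact_imp_closed)
  next
    case False
    have "V = Some ` (Some -` V)"
    proof (intro Set.set_eqI)
      fix u show "u \<in> V \<longleftrightarrow> u \<in> Some ` (Some -` V)"
        using False by (cases u) auto
    qed
    then show ?thesis using R unfolding openin_Alexandroff_compactification
      by (intro disjI1 exI[of _ "Some -` V"]) simp
  qed
qed

lemma continuous_map_rline_homeo:
  fixes h k :: "real \<Rightarrow> real"
  assumes "continuous_on UNIV h" "continuous_on UNIV k"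
    and "\<And>x. h (k x) = x" "\<And>x. k (h x) = x"
  shows "continuous_map rline_top rline_top (map_option h)"
  unfolding continuous_map_alt
proof (intro conjI allI impI)
  fix V assume V: "openin rline_top V"
  have e: "Some -` (map_option h -` V) = h -` (Some -` V)" by auto
  have c: "- (h -` (Some -` V)) = k ` (- (Some -` V))"
  proof (intro Set.set_eqI iffI)
    fix x assume "x \<in> - (h -` (Some -` V))"
    then show "x \<in> k ` (- (Some -` V))" by (intro image_eqI[of _ _ "h x"]) (auto simp: assms)
  qed (auto simp: assms)
  have "openin rline_top (map_option h -` V)"
    unfolding openin_rline e c
    using V assms by (auto simp: openin_rline open_vimage intro!: compact_continuous_image
        intro: continuous_on_subset)
  then show "openin rline_top (map_option h -` V \<inter> topspace rline_top)" by simp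
qed simp

definition rinv :: "rline \<Rightarrow> rline"
  where "rinv u = (case u of None \<Rightarrow> Some 0 | Some x \<Rightarrow> if x = 0 then None else Some (1 / x))"

lemma continuous_map_rinv: "continuous_map rline_top rline_top rinv"
  unfolding continuous_map_alt
proof (intro conjI allI impI)
  fix V assume V: "openin rline_top V"
  define W where "W = Some -` V"
  have W: "open W" "None \<in> V \<Longrightarrow> compact (- W)" using V by (auto simp: W_def openin_rline)
  define W' where "W' = Some -` (rinv -` V)"
  have W': "x \<in> W' \<longleftrightarrow> (if x = 0 then None \<in> V else 1 / x \<in> W)" for x
    by (simp add: W'_def W_def rinv_def)
  have o0: "open ((\<lambda>x. 1 / x) -` W \<inter> (- {0}))"
  proof -
    have "continuous_on (- {0}) (\<lambda>x::real. 1 / x)" by (intro continuous_intros) auto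
    then have "open (- {0} \<inter> (\<lambda>x::real. 1 / x) -` W)"
      by (rule continuous_open_preimage) (auto simp: W)
    then show ?thesis by (simp add: Int_commute)
  qed
  have "open W'"
  proof (subst open_subopen, intro ballI)
    fix x assume x: "x \<in> W'"
    show "\<exists>T. open T \<and> x \<in> T \<and> T \<subseteq> W'"
    proof (cases "x = 0")
      case False
      with x show ?thesis by (intro exI[of _ "(\<lambda>x. 1 / x) -` W \<inter> (- {0})"]) (auto simp: W' o0 split: if_splits)
    next
      case True
      with x have N: "None \<in> V" by (simp add: W')
      then obtain R where R: "R > 0" "\<And>y. y \<notin> W \<Longrightarrow> \<bar>y\<bar> \<le> R"
        using compact_imp_bounded[OF W(2)] by (auto simp: bounded_pos)
      have "y \<in> W'" if "\<bar>y\<bar> < 1 / R" for y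
      proof (cases "y = 0")
        case False
        then have "\<bar>1 / y\<bar> > R" using that R(1) by (simp add: field_simps abs_mult)
        then show ?thesis using R(2)[of "1 / y"] False by (force simp: W')
      qed (simp add: W' N)
      then show ?thesis using R(1) True
        by (intro exI[of _ "ball 0 (1 / R)"]) (auto simp: dist_real_def)
    qed
  qed
  moreover have "compact (- W')" if "Some 0 \<in> V"
  proof -
    have "0 \<in> W" using that by (simp add: W_def)
    then obtain e where e: "e > 0" "\<And>y. \<bar>y\<bar> < e \<Longrightarrow> y \<in> W"
      using W(1) unfolding open_dist by (auto simp: dist_real_def)
    have "\<bar>x\<bar> \<le> 1 / e" if "x \<notin> W'" for x
    proof (rule ccontr)
      assume n: "\<not> \<bar>x\<bar> \<le> 1 / e"
      then have "x \<noteq> 0" using e(1) by auto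
      then have "\<bar>1 / x\<bar> < e" using n e(1) by (simp add: field_simps)
      with e(2) \<open>x \<noteq> 0\<close> that show False by (simp add: W')
    qed
    then have "bounded (- W')" unfolding bounded_real by blast
    with \<open>open W'\<close> show ?thesis by (simp add: compact_eq_bounded_closed closed_Compl)
  qed
  ultimately have "openin rline_top (rinv -` V)"
    by (simp add: openin_rline W'_def[symmetric] rinv_def)
  then show "openin rline_top (rinv -` V \<inter> topspace rline_top)" by simp
qed simp

lemma continuous_map_rmoeb:
  assumes "a \<noteq> -1"
  shows "continuous_map rline_top rline_top (rmoeb a)"
proof -
  have "rmoeb a = map_option (\<lambda>x. 1 + (1 + a) * x) \<circ> rinv \<circ> map_option (\<lambda>x. x - 1)"
  proof
    fix u show "rmoeb a u = (map_option (\<lambda>x. 1 + (1 + a) * x) \<circ> rinv \<circ> map_option (\<lambda>x. x - 1)) u"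
      by (cases u) (auto simp: rmoeb_def rinv_def field_simps)
  qed
  moreover have "1 + a \<noteq> 0" using assms by linarith
  then have "continuous_map rline_top rline_top (map_option (\<lambda>x. 1 + (1 + a) * x))"
    by (intro continuous_map_rline_homeo[where k = "\<lambda>x. (x - 1) / (1 + a)"])
       (auto intro!: continuous_intros)
  moreover have "continuous_map rline_top rline_top (map_option (\<lambda>x::real. x - 1))"
    by (intro continuous_map_rline_homeo[where k = "\<lambda>x. x + 1"]) (auto intro!: continuous_intros)
  ultimately show ?thesis
    by (simp only:) (intro continuous_map_compose[of _ rline_top] continuous_map_rinv)
qed

abbreviation rmult_dom :: "(rline \<times> rline) set"
  where "rmult_dom \<equiv> - {(Some 0, None), (None, Some 0)}"

lemma continuous_map_the:
  "continuous_map (subtopology rline_top (range Some)) euclideanreal the"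
  unfolding continuous_map_alt
proof (intro conjI allI impI)
  fix U :: "real set" assume "openin euclidean U"
  then have "openin rline_top (Some ` U)" by simp
  moreover have "the -` U \<inter> range Some = Some ` U \<inter> range Some" by auto
  ultimately show "openin (subtopology rline_top (range Some))
      (the -` U \<inter> topspace (subtopology rline_top (range Some)))"
    unfolding openin_subtopology topspace_subtopology topspace_rline by blast
qed simp

lemma continuous_map_rmult_finite:
  "continuous_map (subtopology rplane_top (range Some \<times> range Some)) rline_top
     (\<lambda>w. rmult (fst w) (snd w))"
proof -
  let ?S = "prod_topology (subtopology rline_top (range Some)) (subtopology rline_top (range Some))"
  have "continuous_map ?S euclideanreal (\<lambda>w. the (fst w))" 
    using continuous_map_compose[OF continuous_map_fst continuous_map_the] by (simp add: o_def)
  moreover have "continuous_map ?S euclideanreal (\<lambda>w. the (snd w))" 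
    using continuous_map_compose[OF continuous_map_snd continuous_map_the] by (simp add: o_def)
  ultimately have "continuous_map ?S euclideanreal (\<lambda>w. the (fst w) * the (snd w))"
    by (rule continuous_map_real_mult)
  from continuous_map_compose[OF this continuous_map_Some]
  have "continuous_map ?S rline_top (\<lambda>w. Some (the (fst w) * the (snd w)))" by (simp add: o_def)
  then have "continuous_map ?S rline_top (\<lambda>w. rmult (fst w) (snd w))"
    by (rule continuous_map_eq) (auto simp: rmult_def)
  then show ?thesis by (simp add: subtopology_Times)
qed

lemma openin_rplane_finite: "openin rplane_top (range Some \<times> range Some)"
  by (simp add: openin_prod_Times_iff)

lemma continuous_map_rmult:
  "continuous_map (subtopology rplane_top rmult_dom) rline_top (\<lambda>w. rmult (fst w) (snd w))"
  unfolding continuous_map_alt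
proof (intro conjI allI impI)
  fix V assume V: "openin rline_top V"
  let ?F = "range Some \<times> range Some :: (rline \<times> rline) set"
  let ?m = "\<lambda>w. rmult (fst w) (snd w)"
  let ?i = "\<lambda>w. (rinv (fst w), rinv (snd w))"
  have fin: "openin rplane_top {w \<in> ?F. ?m w \<in> U}" if "openin rline_top U" for U
    using openin_continuous_map_preimage[OF continuous_map_rmult_finite that]
    by (simp add: openin_open_subtopology[OF openin_rplane_finite])
  have i: "continuous_map rplane_top rplane_top ?i"
    using continuous_map_compose[OF continuous_map_fst continuous_map_rinv]
      continuous_map_compose[OF continuous_map_snd continuous_map_rinv]
    by (intro continuous_map_pairedI) (auto simp: o_def)
  have "openin rline_top (rinv -` V)"
    using openin_continuous_map_preimage[OF continuous_map_rinv V] by (simp add: vimage_def)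
  from openin_continuous_map_preimage[OF i fin[OF this]]
  have "openin rplane_top {w. ?i w \<in> ?F \<and> rinv (?m (?i w)) \<in> V}" by simp
  moreover have "?m -` V \<inter> rmult_dom =
     ({w \<in> ?F. ?m w \<in> V} \<union> {w. ?i w \<in> ?F \<and> rinv (?m (?i w)) \<in> V}) \<inter> rmult_dom"
  proof (intro Set.set_eqI)
    fix w :: "rline \<times> rline"
    obtain u v where [simp]: "w = (u, v)" by (cases w)
    show "w \<in> ?m -` V \<inter> rmult_dom \<longleftrightarrow>
      w \<in> ({w \<in> ?F. ?m w \<in> V} \<union> {w. ?i w \<in> ?F \<and> rinv (?m (?i w)) \<in> V}) \<inter> rmult_dom"
      by (cases u; cases v) (auto simp: rmult_def rinv_def)
  qed
  ultimately have "openin (subtopology rplane_top rmult_dom) (?m -` V \<inter> rmult_dom)"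
    using fin[OF V] unfolding openin_subtopology by (meson openin_Un)
  then show "openin (subtopology rplane_top rmult_dom)
      (?m -` V \<inter> topspace (subtopology rplane_top rmult_dom))"
    by simp
qed simp

lemma continuous_map_fbar:
  assumes "a \<noteq> -1"
  shows "continuous_map (subtopology rplane_top (- indet a)) rplane_top (fbar a)"
proof -
  let ?S = "subtopology rplane_top (- indet a)"
  have f: "continuous_map ?S rline_top fst" and s: "continuous_map ?S rline_top snd"
    by (auto intro: continuous_map_from_subtopology continuous_map_fst continuous_map_snd)
  have "continuous_map ?S rplane_top (\<lambda>w. (snd w, rmoeb a (fst w)))"
    using continuous_map_compose[OF f continuous_map_rmoeb[OF assms]] s
    by (intro continuous_map_pairedI) (auto simp: o_def)
  moreover have "(\<lambda>w. (snd w, rmoeb a (fst w))) \<in> - indet a \<rightarrow> rmult_dom"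
  proof
    fix w assume "w \<in> - indet a"
    then show "(snd w, rmoeb a (fst w)) \<in> rmult_dom"
      by (cases w; cases "fst w")
         (auto simp: indet_def rmoeb_def add_eq_0_iff split: if_splits)
  qed
  ultimately have "continuous_map ?S (subtopology rplane_top rmult_dom)
      (\<lambda>w. (snd w, rmoeb a (fst w)))"
    by (auto simp: continuous_map_in_subtopology)
  from continuous_map_compose[OF this continuous_map_rmult]
  have "continuous_map ?S rline_top (\<lambda>w. rmult (snd w) (rmoeb a (fst w)))" by (simp add: o_def)
  moreover have "continuous_map rline_top rline_top (map_option (\<lambda>x::real. x + a - 1))"
    by (intro continuous_map_rline_homeo[where k = "\<lambda>x. x - a + 1"])
       (auto intro!: continuous_intros)
  from continuous_map_compose[OF f this]
  have "continuous_map ?S rline_top (\<lambda>w. map_option (\<lambda>x. x + a - 1) (fst w))" by (simp add: o_def)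
  ultimately show ?thesis
    unfolding fbar_def by (rule continuous_map_pairedI)
qed

lemma indet_iter_cong:
  assumes "\<And>w. w \<notin> indet a \<Longrightarrow> h w = fbar a w"
  shows "(\<Union>j<n. (h ^^ j) -` indet a) = indet_iter a n"
    and "w \<notin> indet_iter a n \<Longrightarrow> (h ^^ n) w = (fbar a ^^ n) w"
proof (induction n arbitrary: w)
  case 0
  { case 1 show ?case by (simp add: indet_iter_def) }
  { case 2 show ?case by simp }
next
  case (Suc n)
  have S: "indet_iter a (Suc n) = indet_iter a n \<union> (fbar a ^^ n) -` indet a"
    by (auto simp: indet_iter_def lessThan_Suc)
  { case 1
    have "(\<Union>j<Suc n. (h ^^ j) -` indet a) = indet_iter a n \<union> (h ^^ n) -` indet a"
      using Suc(1) by (auto simp: lessThan_Suc)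
    also have "\<dots> = indet_iter a n \<union> (fbar a ^^ n) -` indet a"
      using Suc(2) by auto
    finally show ?case by (simp add: S) }
  { case 2
    then have "w \<notin> indet_iter a n" "(fbar a ^^ n) w \<notin> indet a" by (auto simp: S)
    then show ?case using Suc(2)[of w] assms by simp }
qed

end

theory Submission
  imports Defs
begin

text \<open>Along a finite orbit \<open>y\<^sub>k = x\<^sub>k\<^sub>-\<^sub>1 + a - 1\<close>, so the orbit is a solution of a second-order
recursion. Put \<open>m = (1 - a) / 2\<close> and \<open>d = m - 1 = - (1 + a) / 2 > 0\<close>, and measure \<open>x\<close> from the
fixed point: \<open>t\<^sub>k\<^sub>+\<^sub>1 = x\<^sub>k - m\<close>, equivalently \<open>t\<^sub>k = y\<^sub>k + m\<close>. Then
\[ (t_{k+2} + m)(t_{k+1} + d) = (t_k - m)(t_{k+1} - d). \]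
For a saddle it suffices that the derivative around the cycle has determinant \<open>1\<close> and no eigenvalue
of modulus \<open>1\<close>.

\<^bold>\<open>Determinant.\<close> The map \<open>f\<close> multiplies the function \<open>y - x + 1\<close> by \<open>- (x + a) / (x - 1)\<close>, and this
factor is also the Jacobian determinant of \<open>f\<close>; that is, \<open>f\<close> preserves the area form
\<open>dx dy / (y - x + 1)\<close>. On the line \<open>y = x - 1\<close>, where the form has its pole, \<open>f\<close> is the translation
by \<open>(a, a)\<close>, so no cycle meets that line and the determinant around a cycle is \<open>1\<close>.

\<^bold>\<open>Eigenvalues.\<close> If \<open>t\<^sub>k \<le> m\<close> and \<open>t\<^sub>k\<^sub>+\<^sub>1 < - d\<close>, then the sequence loses at least \<open>2 m\<close> in every two
steps from then on, and is not periodic; the same holds under the time-reversing symmetry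
\<open>t \<mapsto> - t\<close>. Hence every term of a cycle is either central, \<open>\<bar>t\<^sub>k\<bar> < d\<close>, or a member of a pair
\<open>t\<^sub>k > m\<close>, \<open>t\<^sub>k\<^sub>+\<^sub>1 < - m\<close>. Logarithmic differentiation of the recursion shows that a tangent vector
evolves by
\[ \frac{\xi_{k+2}}{m + t_{k+2}} + \frac{2 d\, \xi_{k+1}}{d^2 - t_{k+1}^2} + \frac{\xi_k}{m - t_k} = 0. \]
The three signs are \<open>(+,+,+)\<close>, \<open>(-,-,+)\<close> or \<open>(+,-,-)\<close> according as \<open>t\<^sub>k\<^sub>+\<^sub>1\<close> is central, large
positive or large negative. Estimating the middle, the first or the last term, respectively, by the
other two leads to one and the same inequality
\[ \frac{2 d}{d^2 - t_{k+1}^2} |\xi_{k+1}| \le \frac{1}{m + t_{k+2}} |\xi_{k+2}| + \frac{1}{m - t_k} |\xi_k|, \]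
in which the coefficients carry their signs. If the eigenvalue has modulus \<open>1\<close>, then \<open>\<bar>\<xi>\<^sub>k\<bar>\<close> is
periodic, and summation over a cycle gives \<open>\<Sum> c\<^sub>k \<bar>\<xi>\<^sub>k\<bar> \<le> 0\<close> with
\[ c_k = \frac{2 d}{d^2 - t_k^2} - \frac{1}{m + t_k} - \frac{1}{m - t_k}
   = \frac{2 (m - d)(d m + t_k^2)}{(d^2 - t_k^2)(m^2 - t_k^2)} > 0, \]
so \<open>\<xi> = 0\<close> (\<open>norm_cyclic_variation_zero\<close>). In matrix terms, the cyclic tridiagonal matrix of the
variational equation becomes strictly diagonally dominant by columns once the two rows of every
pair are exchanged.

\<^bold>\<open>Infinity.\<close> An orbit that reaches \<open>x = 1\<close> goes to infinity, where it alternates between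
points \<open>(\<infinity>, y)\<close> with \<open>y \<le> a\<close> and \<open>(x, \<infinity>)\<close> with \<open>x \<le> a\<close>; because \<open>a < -1\<close> it stays there. A cycle
through a finite point therefore lies in the finite plane off \<open>x = 1\<close>, where the extension of \<open>f\<close> is
\<open>f\<close> itself.\<close>

section \<open>Periodic solutions of the centred recursion\<close>

locale centred_cycle =
  fixes t :: "nat \<Rightarrow> real" and m d :: real and N :: nat
  assumes d_pos: "0 < d" and d_less_m: "d < m"
    and N_pos: "0 < N"
    and cyclic: "t (k + N) = t k"
    and recur: "(t (k + 2) + m) * (t (k + 1) + d) = (t k - m) * (t (k + 1) - d)"
    and t_neq: "t k \<noteq> d" "t k \<noteq> - d"
begin

lemma cyclic_mult: "t (k + j * N) = t k"
proof (induction j)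
  case (Suc j)
  have "t (k + Suc j * N) = t ((k + j * N) + N)" by (simp add: algebra_simps)
  then show ?case using cyclic Suc by simp
qed simp

lemma no_two_step_drift:
  assumes "\<And>j. t (k + 2 * j + 2) \<le> t (k + 2 * j) - 2 * m"
  shows False
proof -
  have "t (k + 2 * j) \<le> t k - 2 * m * real j" for j
  proof (induction j)
    case (Suc j)
    then show ?case using assms[of j] by (simp add: algebra_simps)
  qed simp
  from this[of N] have "2 * m * real N \<le> 0" using cyclic_mult[of k 2] by simp
  moreover have "0 < 2 * m * real N" using d_pos d_less_m N_pos by simp
  ultimately show False by simp
qed

text \<open>If the conclusion failed, \<open>t k \<le> m\<close> and \<open>t (k + 1) < - d\<close> would reproduce themselves one step later, since
\<open>(t (k + 1) - d) / (t (k + 1) + d) \<ge> 1\<close> pushes \<open>t (k + 2)\<close> down to at most \<open>t k - 2 * m\<close>. This is an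
endless drift.\<close>

lemma left_after_right:
  assumes "t (k + 1) < - d"
  shows "m < t k"
proof (rule ccontr)
  assume "\<not> m < t k"
  have step: "t (j + 2) \<le> t j - 2 * m" if "t j \<le> m" "t (j + 1) < - d" for j
  proof (rule ccontr)
    assume "\<not> t (j + 2) \<le> t j - 2 * m"
    then have "(t (j + 2) + m) * (t (j + 1) + d) < (t j - m) * (t (j + 1) + d)"
      using that by (intro mult_strict_right_mono_neg) auto
    then have "0 < 2 * d * (t j - m)"
      unfolding recur by (simp add: algebra_simps)
    with that d_pos show False by (simp add: zero_less_mult_iff)
  qed
  have inv: "t (k + j) \<le> m \<and> t (k + j + 1) < - d" for j
  proof (induction j)
    case 0
    then show ?case using assms \<open>\<not> m < t k\<close> by simp
  next
    case (Suc j)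
    with step[of "k + j"] d_pos d_less_m show ?case by simp
  qed
  show False
    using step inv[of "2 * j" for j] by (intro no_two_step_drift[of k]) (metis add.assoc)
qed

text \<open>The mirror image of the previous lemma: the recursion is invariant under reversing the time and the
sign of \<open>t\<close>, so here the drift happens towards the past. Periodicity turns an endless past into
statements about all indices.\<close>

lemma right_then_left:
  assumes "d < t k"
  shows "t (k + 1) < - m"
proof (rule ccontr)
  assume neg: "\<not> t (k + 1) < - m"
  have step: "t (j + 2) \<le> t j - 2 * m" if "- m \<le> t (j + 2)" "d < t (j + 1)" for j
  proof (rule ccontr)
    assume "\<not> t (j + 2) \<le> t j - 2 * m"
    then have "(t j - m) * (t (j + 1) - d) < (t (j + 2) + m) * (t (j + 1) - d)"
      using that by (intro mult_strict_right_mono) auto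
    then have "0 < (t (j + 2) + m) * (t (j + 1) - d) - (t (j + 2) + m) * (t (j + 1) + d)"
      unfolding recur by simp
    then have "2 * d * (t (j + 2) + m) < 0"
      by (simp add: algebra_simps)
    with that d_pos show False by (simp add: mult_less_0_iff)
  qed
  let ?P = "\<lambda>j. d < t j \<and> - m \<le> t (j + 1)"
  have backward: "?P j" if "?P (j + 1)" for j
    using step[of j] that d_less_m d_pos by (simp add: numeral_2_eq_2)
  \<comment> \<open>Indices cannot go below \<open>0\<close>, so the backward steps start \<open>i\<close> periods after \<open>k\<close>.\<close>
  have "?P (k + i * N - j)" if "j \<le> k + i * N" for i j
    using that
  proof (induction j)
    case 0
    have "t (k + i * N + 1) = t (k + 1)"
      using cyclic_mult[of "k + 1" i] by (simp add: algebra_simps)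
    then show ?case using assms neg cyclic_mult by simp
  next
    case (Suc j)
    then show ?case using backward[of "k + i * N - Suc j"] by (simp add: Suc_diff_Suc)
  qed
  moreover have "j \<le> k + j * N" for j using N_pos by (cases N) auto
  ultimately have inv: "?P j" for j
    by (metis diff_diff_cancel diff_le_self)
  then show False
    using step inv[of "Suc j" for j] by (intro no_two_step_drift[of 0]) (simp add: numeral_2_eq_2)
qed

text \<open>The gaps \<open>d < \<bar>t k\<bar> \<le> m\<close> are empty: a term beyond \<open>\<plusminus> d\<close> has its partner on the other side, which in
turn forces it beyond \<open>\<plusminus> m\<close>.\<close>

lemma trichotomy:
  obtains (centre) "- d < t k" "t k < d" | (right) "m < t k" | (left) "t k < - m"
proof -
  consider "- d < t k" "t k < d" | "d < t k" | "t k < - d"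
    using t_neq[of k] by linarith
  then show ?thesis
  proof cases
    case 2
    then have "t (k + 1) < - d" using right_then_left[of k] d_less_m by linarith
    then show ?thesis using left_after_right right by blast
  next
    case 3
    \<comment> \<open>The predecessor of \<open>k\<close> along the cycle, also for \<open>k = 0\<close>.\<close>
    define j where "j = k + N - 1"
    have j: "t (j + 1) = t k" using cyclic N_pos by (simp add: j_def)
    with 3 have "m < t j" using left_after_right[of j] by simp
    then have "t (j + 1) < - m" using right_then_left[of j] d_less_m by linarith
    then show ?thesis using j left by simp
  qed (rule centre)
qed

lemma t_neq_m: "t k \<noteq> m" "t k \<noteq> - m"
  using d_pos d_less_m by (cases k rule: trichotomy; simp)+

lemma square_gaps:
  shows "- d < t k \<Longrightarrow> t k < d \<Longrightarrow> 0 < d\<^sup>2 - (t k)\<^sup>2 \<and> 0 < m\<^sup>2 - (t k)\<^sup>2"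
    and "m < t k \<or> t k < - m \<Longrightarrow> d\<^sup>2 - (t k)\<^sup>2 < 0 \<and> m\<^sup>2 - (t k)\<^sup>2 < 0"
proof -
  have sq: "d\<^sup>2 < m\<^sup>2" using d_pos d_less_m by (intro power_strict_mono) auto
  show "0 < d\<^sup>2 - (t k)\<^sup>2 \<and> 0 < m\<^sup>2 - (t k)\<^sup>2" if "- d < t k" "t k < d"
  proof -
    have "(t k)\<^sup>2 < d\<^sup>2" using that abs_le_square_iff[of d "t k"] by linarith
    with sq show ?thesis by simp
  qed
  show "d\<^sup>2 - (t k)\<^sup>2 < 0 \<and> m\<^sup>2 - (t k)\<^sup>2 < 0" if "m < t k \<or> t k < - m"
  proof -
    have "m\<^sup>2 < (t k)\<^sup>2" using that abs_le_square_iff[of "t k" m] d_pos d_less_m by linarith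
    with sq show ?thesis by simp
  qed
qed

text \<open>The total coefficient with which \<open>norm (\<xi> k)\<close> occurs when the inequalities of all steps are added. The
trichotomy enters because \<open>d\<^sup>2 - (t k)\<^sup>2\<close> and \<open>m\<^sup>2 - (t k)\<^sup>2\<close> must have the same sign.\<close>

lemma column_sum_pos: "0 < 2 * d / (d\<^sup>2 - (t k)\<^sup>2) - 1 / (m + t k) - 1 / (m - t k)"
proof -
  have "(d\<^sup>2 - (t k)\<^sup>2 > 0 \<and> m\<^sup>2 - (t k)\<^sup>2 > 0) \<or> (d\<^sup>2 - (t k)\<^sup>2 < 0 \<and> m\<^sup>2 - (t k)\<^sup>2 < 0)"
    using square_gaps by (cases k rule: trichotomy) blast+
  then have pos: "0 < (d\<^sup>2 - (t k)\<^sup>2) * (m\<^sup>2 - (t k)\<^sup>2)"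
    by (auto simp: zero_less_mult_iff)
  then have nz: "d\<^sup>2 - (t k)\<^sup>2 \<noteq> 0" "m\<^sup>2 - (t k)\<^sup>2 \<noteq> 0" by auto
  have nz': "m + t k \<noteq> 0" "m - t k \<noteq> 0" using t_neq_m[of k] by auto
  have "1 / (m + t k) + 1 / (m - t k) = 2 * m / (m\<^sup>2 - (t k)\<^sup>2)"
    using nz nz' by (simp add: divide_simps) (simp add: algebra_simps power2_eq_square)
  then have "2 * d / (d\<^sup>2 - (t k)\<^sup>2) - 1 / (m + t k) - 1 / (m - t k)
      = 2 * d / (d\<^sup>2 - (t k)\<^sup>2) - 2 * m / (m\<^sup>2 - (t k)\<^sup>2)" by linarith
  also have "\<dots> = 2 * (m - d) * (d * m + (t k)\<^sup>2) / ((d\<^sup>2 - (t k)\<^sup>2) * (m\<^sup>2 - (t k)\<^sup>2))"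
    using nz by (simp add: divide_simps) (simp add: algebra_simps power2_eq_square)
  also have "\<dots> > 0"
    using d_pos d_less_m by (intro divide_pos_pos[OF _ pos] mult_pos_pos add_pos_nonneg) auto
  finally show ?thesis .
qed

text \<open>Strict column dominance of the variational equation. The first assumption is the linearisation of the
recursion; the second holds for the solutions that are multiplied by a number of modulus \<open>1\<close> in every
period.\<close>

lemma norm_cyclic_variation_zero:
  fixes \<xi> :: "nat \<Rightarrow> 'b::real_normed_vector"
  assumes var: "\<And>k. \<xi> (k + 2) = (2 * d * (t k - m) / (t (k + 1) + d)\<^sup>2) *\<^sub>R \<xi> (k + 1)
                    + ((t (k + 1) - d) / (t (k + 1) + d)) *\<^sub>R \<xi> k"
    and norm_cyclic: "\<And>k. norm (\<xi> (k + N)) = norm (\<xi> k)"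
  shows "\<xi> k = 0"
proof -
  define \<alpha> \<beta> \<gamma> where "\<alpha> k = 1 / (m + t k)" and "\<beta> k = 2 * d / (d\<^sup>2 - (t k)\<^sup>2)"
    and "\<gamma> k = 1 / (m - t k)" for k
  \<comment> \<open>The linearised step in the form obtained by logarithmic differentiation.\<close>
  have coef: "\<alpha> (k + 2) * (2 * d * (t k - m) / (t (k + 1) + d)\<^sup>2) = - \<beta> (k + 1)"
    "\<alpha> (k + 2) * ((t (k + 1) - d) / (t (k + 1) + d)) = - \<gamma> k" for k
  proof -
    define s u v where "s = t k" and "u = t (k + 1)" and "v = t (k + 2)"
    have nz: "u + d \<noteq> 0" "u - d \<noteq> 0" "v + m \<noteq> 0" "s - m \<noteq> 0"
      using t_neq[of "k + 1"] t_neq_m[of "k + 2"] t_neq_m[of k]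
      by (auto simp: s_def u_def v_def add_eq_0_iff)
    have "v + m = (s - m) * (u - d) / (u + d)"
      using recur[of k] nz by (simp add: s_def u_def v_def eq_divide_eq)
    then have \<alpha>: "\<alpha> (k + 2) = (u + d) / ((s - m) * (u - d))"
      by (simp add: \<alpha>_def v_def add.commute)
    have \<beta>: "\<beta> (k + 1) = - (2 * d / ((u - d) * (u + d)))"
      by (simp add: \<beta>_def u_def power2_eq_square algebra_simps flip: divide_minus_right)
    have \<gamma>: "\<gamma> k = - (1 / (s - m))"
      by (simp add: \<gamma>_def s_def flip: divide_minus_right)
    show "\<alpha> (k + 2) * (2 * d * (t k - m) / (t (k + 1) + d)\<^sup>2) = - \<beta> (k + 1)"
      unfolding \<alpha> \<beta> using nz by (simp add: s_def u_def power2_eq_square)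
    show "\<alpha> (k + 2) * ((t (k + 1) - d) / (t (k + 1) + d)) = - \<gamma> k"
      unfolding \<alpha> \<gamma> using nz by (simp add: s_def u_def)
  qed
  have lin: "\<alpha> (k + 2) *\<^sub>R \<xi> (k + 2) + \<beta> (k + 1) *\<^sub>R \<xi> (k + 1) + \<gamma> k *\<^sub>R \<xi> k = 0" for k
    unfolding var[of k] scaleR_add_right scaleR_scaleR coef by simp
  \<comment> \<open>The term to be estimated by the other two depends on the position of \<open>t (k + 1)\<close>; its sign is
    always such that the result has this form.\<close>
  have row: "\<beta> (k + 1) * norm (\<xi> (k + 1)) - \<alpha> (k + 2) * norm (\<xi> (k + 2)) - \<gamma> k * norm (\<xi> k) \<le> 0" for k
  proof -
    define a b c where "a = \<alpha> (k + 2) *\<^sub>R \<xi> (k + 2)" and "b = \<beta> (k + 1) *\<^sub>R \<xi> (k + 1)"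
      and "c = \<gamma> k *\<^sub>R \<xi> k"
    have abc: "a + b + c = 0" using lin by (simp add: a_def b_def c_def)
    have "b = - (a + c)" "a = - (b + c)" "c = - (a + b)" 
      using abc by (auto simp: eq_neg_iff_add_eq_0 algebra_simps)
    then have tri: "norm b \<le> norm a + norm c" "norm a \<le> norm b + norm c" "norm c \<le> norm a + norm b"
      using norm_minus_cancel norm_triangle_ineq by metis+
    have norms: "norm a = \<bar>\<alpha> (k + 2)\<bar> * norm (\<xi> (k + 2))"
      "norm b = \<bar>\<beta> (k + 1)\<bar> * norm (\<xi> (k + 1))" "norm c = \<bar>\<gamma> k\<bar> * norm (\<xi> k)"
      by (simp_all add: a_def b_def c_def)
    have \<alpha>_sign: "t (k + 2) < - m \<Longrightarrow> \<alpha> (k + 2) < 0" "- m < t (k + 2) \<Longrightarrow> 0 < \<alpha> (k + 2)"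
      by (auto simp: \<alpha>_def)
    have \<gamma>_sign: "m < t k \<Longrightarrow> \<gamma> k < 0" "t k < m \<Longrightarrow> 0 < \<gamma> k"
      by (auto simp: \<gamma>_def)
    have \<beta>_pos: "\<beta> (k + 1) > 0" if "- d < t (k + 1)" "t (k + 1) < d"
      using square_gaps(1)[OF that] d_pos by (simp add: \<beta>_def)
    have \<beta>_neg: "\<beta> (k + 1) < 0" if "m < t (k + 1) \<or> t (k + 1) < - m"
      using square_gaps(2)[OF that] d_pos by (simp add: \<beta>_def divide_pos_neg)
    show ?thesis
    proof (cases "k + 1" rule: trichotomy)
      case centre
      then have "- m < t (k + 2)" "t k < m"
        using left_after_right[of "k + 1"] right_then_left[of k] d_less_m d_pos t_neq_m
        by (force simp: not_less numeral_2_eq_2)+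
      then show ?thesis
        using \<beta>_pos[OF centre] \<alpha>_sign \<gamma>_sign tri(1) by (simp add: norms)
    next
      case right
      then have "t (k + 2) < - m" "t k < m"
        using right_then_left[of "k + 1"] right_then_left[of k] d_less_m d_pos t_neq_m
        by (force simp: not_less numeral_2_eq_2)+
      then show ?thesis
        using \<beta>_neg right \<alpha>_sign \<gamma>_sign tri(2) by (simp add: norms)
    next
      case left
      then have "- m < t (k + 2)" "m < t k"
        using left_after_right[of "k + 1"] left_after_right[of k] d_less_m d_pos t_neq_m
        by (force simp: not_less numeral_2_eq_2)+
      then show ?thesis
        using \<beta>_neg left \<alpha>_sign \<gamma>_sign tri(3) by (simp add: norms)
    qed
  qed
  define S where "S F = (\<Sum>k<N. F k)" for F :: "nat \<Rightarrow> real"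
  have shift: "S (\<lambda>k. F (k + 1)) = S F" if "\<And>k. F (k + N) = F k" for F
  proof -
    have "S (\<lambda>k. F (k + 1)) + F 0 = (\<Sum>k<Suc N. F k)"
      unfolding S_def sum.lessThan_Suc_shift by simp
    also have "\<dots> = S F + F 0" using that[of 0] by (simp add: S_def)
    finally show ?thesis by simp
  qed
  define A B C where "A k = \<alpha> k * norm (\<xi> k)" and "B k = \<beta> k * norm (\<xi> k)"
    and "C k = \<gamma> k * norm (\<xi> k)" for k
  have cyc: "A (k + N) = A k" "B (k + N) = B k" for k
    by (simp_all add: A_def B_def \<alpha>_def \<beta>_def cyclic norm_cyclic)
  have "S (\<lambda>k. A (k + 2)) = S A"
    using shift[of A] shift[of "\<lambda>k. A (Suc k)"] cyc(1) cyc(1)[of "Suc k" for k] by simp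
  moreover have "S (\<lambda>k. B (k + 1)) = S B" using shift cyc by blast
  moreover have "S (\<lambda>k. B (k + 1) - A (k + 2) - C k) \<le> 0"
    unfolding S_def using row by (intro sum_nonpos) (simp add: A_def B_def C_def)
  ultimately have "S (\<lambda>k. B k - A k - C k) \<le> 0"
    by (simp add: S_def sum_subtractf)
  moreover have column_eq: "B k - A k - C k = (\<beta> k - \<alpha> k - \<gamma> k) * norm (\<xi> k)" for k
    by (simp add: A_def B_def C_def algebra_simps)
  have "\<beta> k - \<alpha> k - \<gamma> k > 0" for k
    using column_sum_pos by (simp add: \<alpha>_def \<beta>_def \<gamma>_def)
  note column = this
  have nn: "B k - A k - C k \<ge> 0" for k unfolding column_eq using column[of k] by simp
  ultimately have "\<forall>k<N. B k - A k - C k = 0"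
    using sum_nonneg_eq_0_iff[of "{..<N}" "\<lambda>k. B k - A k - C k"] sum_nonneg[of "{..<N}" "\<lambda>k. B k - A k - C k"]
    by (simp add: S_def order_antisym)
  then have zero: "\<xi> k = 0" if "k < N" for k
    using that column[of k] unfolding column_eq by auto
  have "norm (\<xi> (k mod N + j * N)) = norm (\<xi> (k mod N))" for j
  proof (induction j)
    case (Suc j)
    then show ?case using norm_cyclic[of "k mod N + j * N"] by (simp add: algebra_simps)
  qed simp
  from this[of "k div N"] show ?thesis using zero[of "k mod N"] N_pos by simp
qed

end


section \<open>Orbits through infinity and derivatives of the iterates\<close>

text \<open>The points at infinity that receive the orbits leaving the finite plane through \<open>x = 1\<close>:
these continue as \<open>(\<infinity>, a)\<close>, \<open>(a, \<infinity>)\<close>, \<open>(\<infinity>, 2 a - 1)\<close>, \<open>(2 a - 1, \<infinity>)\<close>, and so on.\<close>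

definition escaping :: "real \<Rightarrow> (rline \<times> rline) set"
  where "escaping a = {(None, Some y) |y. y \<le> a} \<union> {(Some x, None) |x. x \<le> a}"

lemma fbar_escaping:
  assumes "a < -1" "w \<in> escaping a"
  shows "fbar a w \<in> escaping a"
proof -
  consider y where "w = (None, Some y)" "y \<le> a" | x where "w = (Some x, None)" "x \<le> a"
    using assms(2) by (auto simp: escaping_def)
  then show ?thesis
  proof cases
    case 1
    then show ?thesis by (simp add: escaping_def fbar_def rmult_def rmoeb_def)
  next
    case 2
    then show ?thesis using assms(1) by (simp add: escaping_def fbar_def rmult_def rmoeb_def)
  qed
qed

lemma fbar_iter_escaping:
  assumes "a < -1" "w \<in> escaping a"
  shows "(fbar a ^^ i) w \<in> escaping a"
proof (induction i)
  case 0
  then show ?case using assms(2) by simp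
next
  case (Suc i)
  then show ?case using fbar_escaping[OF assms(1)] by simp
qed

lemma fbar_pole_escaping: "fst z = 1 \<Longrightarrow> fbar a (emb z) \<in> escaping a"
  by (simp add: escaping_def fbar_def emb_def rmult_def rmoeb_def)

lemma fin_part_emb: "fin_part (emb z) = z"
  by (simp add: fin_part_def emb_def)

lemma fbar_iter_emb:
  assumes "\<And>i. i < n \<Longrightarrow> fst ((fmap a ^^ i) z) \<noteq> 1"
  shows "(fbar a ^^ n) (emb z) = emb ((fmap a ^^ n) z)"
  using assms
proof (induction n)
  case 0
  show ?case by simp
next
  case (Suc n)
  then have "(fbar a ^^ n) (emb z) = emb ((fmap a ^^ n) z)" by simp
  then show ?case using Suc.prems[of n] by (simp add: fbar_extends)
qed

text \<open>Where the orbit first meets the pole \<open>x = 1\<close>, it enters the forward invariant set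
\<^term>\<open>escaping a\<close>, which contains no finite point.\<close>

lemma returning_orbit_finite:
  assumes a: "a < -1" and ret: "(fbar a ^^ n) (emb p) \<in> range emb" and "i < n"
  shows "fst ((fmap a ^^ i) p) \<noteq> 1"
  using \<open>i < n\<close>
proof (induction i rule: less_induct)
  case (less i)
  show ?case
  proof
    assume pole: "fst ((fmap a ^^ i) p) = 1"
    have "(fbar a ^^ i) (emb p) = emb ((fmap a ^^ i) p)"
      using less by (intro fbar_iter_emb) auto
    then have "(fbar a ^^ Suc i) (emb p) \<in> escaping a"
      using fbar_pole_escaping[OF pole] by simp
    then have "(fbar a ^^ (n - Suc i)) ((fbar a ^^ Suc i) (emb p)) \<in> escaping a"
      by (rule fbar_iter_escaping[OF a])
    then have "(fbar a ^^ n) (emb p) \<in> escaping a"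
      using \<open>i < n\<close> by (simp add: less.prems flip: funpow_add comp_apply[of "fbar a ^^ (n - Suc i)"] del: funpow.simps)
    with ret show False by (auto simp: escaping_def emb_def)
  qed
qed

definition fmap_deriv :: "real \<Rightarrow> real \<times> real \<Rightarrow> real \<times> real \<Rightarrow> real \<times> real"
  where "fmap_deriv a z w =
    (snd z * (- (1 + a) / (fst z - 1)\<^sup>2) * fst w + (fst z + a) / (fst z - 1) * snd w, fst w)"

lemma fmap_has_derivative:
  assumes "fst z \<noteq> 1"
  shows "(fmap a has_derivative fmap_deriv a z) (at z)"
proof -
  have moeb: "((\<lambda>x. (x + a) / (x - 1)) has_real_derivative - (1 + a) / (fst z - 1)\<^sup>2) (at (fst z))"
    using assms by (auto intro!: derivative_eq_intros simp: power2_eq_square)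
  have fst: "(fst has_derivative fst) (at z)" by (intro derivative_intros)
  have snd: "(snd has_derivative snd) (at z)" by (intro derivative_intros)
  have "((\<lambda>z. (fst z + a) / (fst z - 1)) has_derivative (\<lambda>w. - (1 + a) / (fst z - 1)\<^sup>2 * fst w)) (at z)"
    using has_derivative_compose[OF fst moeb[unfolded has_field_derivative_def]] by simp
  note has_derivative_mult[OF snd this]
  moreover have "((\<lambda>z. fst z + a - 1) has_derivative fst) (at z)"
    using has_derivative_diff[OF has_derivative_add[OF fst has_derivative_const[of a]] has_derivative_const[of 1]]
    by simp
  ultimately have "((\<lambda>z. (snd z * ((fst z + a) / (fst z - 1)), fst z + a - 1)) has_derivative fmap_deriv a z) (at z)"
    unfolding fmap_deriv_def
    by (rule has_derivative_Pair[THEN has_derivative_eq_rhs]) (simp add: fun_eq_iff mult.assoc mult.commute)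
  then show ?thesis by (simp add: fmap_def[abs_def] split_beta)
qed

text \<open>The chain rule product of the derivatives along the orbit of \<open>p\<close>. The second component at time \<open>k + 1\<close> is
the first one at time \<open>k\<close>, so the second components alone satisfy a second-order recursion.\<close>

primrec orbit_deriv :: "real \<Rightarrow> real \<times> real \<Rightarrow> nat \<Rightarrow> real \<times> real \<Rightarrow> real \<times> real"
  where "orbit_deriv a p 0 = (\<lambda>w. w)"
  | "orbit_deriv a p (Suc k) = (\<lambda>w. fmap_deriv a ((fmap a ^^ k) p) (orbit_deriv a p k w))"

lemma fmap_iter_has_derivative:
  assumes "\<And>i. i < n \<Longrightarrow> fst ((fmap a ^^ i) p) \<noteq> 1"
  shows "((fmap a ^^ n) has_derivative orbit_deriv a p n) (at p)"
  using assms
proof (induction n)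
  case 0
  then show ?case by (simp add: id_def has_derivative_ident)
next
  case (Suc n)
  have "(fmap a \<circ> (fmap a ^^ n) has_derivative fmap_deriv a ((fmap a ^^ n) p) \<circ> orbit_deriv a p n) (at p)"
    using Suc by (intro diff_chain_at fmap_has_derivative) auto
  then show ?case by (simp add: o_def)
qed

text \<open>The extended iterate and the iterate of \<^const>\<open>fmap\<close> agree near \<open>p\<close>, because the finitely many
conditions \<open>x \<noteq> 1\<close> along the orbit are open.\<close>

lemma fbar_iter_has_derivative:
  assumes "\<And>i. i < n \<Longrightarrow> fst ((fmap a ^^ i) p) \<noteq> 1"
  shows "((\<lambda>z. fin_part ((fbar a ^^ n) (emb z))) has_derivative orbit_deriv a p n) (at p)"
proof -
  have "eventually (\<lambda>z. fst ((fmap a ^^ i) z) \<noteq> 1) (at p)" if "i < n" for i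
  proof -
    have "isCont (fmap a ^^ i) p"
      using that assms by (intro has_derivative_continuous[OF fmap_iter_has_derivative]) auto
    then have "((\<lambda>z. fst ((fmap a ^^ i) z)) \<longlongrightarrow> fst ((fmap a ^^ i) p)) (at p)"
      unfolding isCont_def by (rule tendsto_fst)
    then show ?thesis using assms[OF that] by (rule tendsto_imp_eventually_ne)
  qed
  then have "eventually (\<lambda>z. \<forall>i\<in>{..<n}. fst ((fmap a ^^ i) z) \<noteq> 1) (at p)"
    by (intro eventually_ball_finite) auto
  then have "eventually (\<lambda>z. (fmap a ^^ n) z = fin_part ((fbar a ^^ n) (emb z))) (at p)"
    by eventually_elim (simp add: fbar_iter_emb fin_part_emb)
  moreover have "(fmap a ^^ n) p = fin_part ((fbar a ^^ n) (emb p))"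
    using assms by (simp add: fbar_iter_emb fin_part_emb)
  ultimately show ?thesis
    using has_derivative_transform_eventually[OF fmap_iter_has_derivative[OF assms]] by auto
qed

section \<open>The invariant area form\<close>

abbreviation jac_det :: "(real \<times> real \<Rightarrow> real \<times> real) \<Rightarrow> real"
  where "jac_det D \<equiv> fst (D (1, 0)) * snd (D (0, 1)) - fst (D (0, 1)) * snd (D (1, 0))"

text \<open>The factor on the right is the Jacobian determinant of \<^const>\<open>fmap\<close>, so this is the invariance of the
area form \<open>dx dy / (y - x + 1)\<close>; the next lemma is its integrated form along an orbit.\<close>

lemma fmap_line_defect:
  assumes "fst z \<noteq> 1"
  shows "snd (fmap a z) - fst (fmap a z) + 1 = - ((fst z + a) / (fst z - 1)) * (snd z - fst z + 1)"
proof -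
  define r where "r = (fst z + a) / (fst z - 1)"
  have "r * (fst z - 1) = fst z + a" using assms by (simp add: r_def)
  then have "fst z + a - snd z * r = - r * (snd z - fst z + 1)" by (simp add: algebra_simps)
  then show ?thesis by (simp add: fmap_def split_beta del: times_divide_eq_right flip: r_def)
qed

lemma jac_det_orbit_deriv:
  assumes "\<And>i. i < n \<Longrightarrow> fst ((fmap a ^^ i) p) \<noteq> 1"
  shows "jac_det (orbit_deriv a p n) * (snd p - fst p + 1)
       = snd ((fmap a ^^ n) p) - fst ((fmap a ^^ n) p) + 1"
  using assms
proof (induction n)
  case (Suc n)
  define q where "q = (fmap a ^^ n) p"
  have "jac_det (orbit_deriv a p (Suc n)) = - ((fst q + a) / (fst q - 1)) * jac_det (orbit_deriv a p n)"
  proof -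
    have "(A * f1 + B * s1) * f2 - (A * f2 + B * s2) * f1 = - B * (f1 * s2 - f2 * s1)"
      for A B f1 f2 s1 s2 :: real by (simp add: algebra_simps)
    then show ?thesis
      unfolding orbit_deriv.simps fmap_deriv_def q_def[symmetric] fst_conv snd_conv .
  qed
  then have "jac_det (orbit_deriv a p (Suc n)) * (snd p - fst p + 1)
      = - ((fst q + a) / (fst q - 1)) * (jac_det (orbit_deriv a p n) * (snd p - fst p + 1))"
    by (simp only: mult.assoc)
  also have "jac_det (orbit_deriv a p n) * (snd p - fst p + 1) = snd q - fst q + 1"
    unfolding q_def using Suc by simp
  also have "- ((fst q + a) / (fst q - 1)) * (snd q - fst q + 1) = snd (fmap a q) - fst (fmap a q) + 1"
    using fmap_line_defect[of q a] Suc.prems[of n] by (simp add: q_def)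
  finally show ?case by (simp only: q_def funpow.simps comp_apply)
qed simp

lemma fmap_line: "u \<noteq> 1 \<Longrightarrow> fmap a (u, u - 1) = (u + a, u + a - 1)"
  by (simp add: fmap_def)

lemma line_orbit:
  assumes "\<And>i. fst ((fmap a ^^ i) p) \<noteq> 1" and "snd p = fst p - 1"
  shows "(fmap a ^^ n) p = (fst p + real n * a, fst p + real n * a - 1)"
proof (induction n)
  case 0
  then show ?case using assms(2) by (simp add: prod_eq_iff)
next
  case (Suc n)
  then have "fst p + real n * a \<noteq> 1" using assms(1)[of n] by simp
  then have "(fmap a ^^ Suc n) p = (fst p + real n * a + a, fst p + real n * a + a - 1)"
    using fmap_line Suc by simp
  then show ?case by (simp add: algebra_simps)
qed

section \<open>Eigenvalues of the Jacobian matrix\<close>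

lemma det_mat_2_2:
  fixes A :: "'a::comm_ring_1 mat"
  assumes "A \<in> carrier_mat 2 2"
  shows "Determinant.det A = A $$ (0, 0) * A $$ (1, 1) - A $$ (0, 1) * A $$ (1, 0)"
proof -
  have "Determinant.det (mat_delete A 0 j) = A $$ (1, 1 - j)" if "j < 2" for j
    using assms that by (subst det_single) (auto simp: mat_delete_def less_2_cases_iff)
  then show ?thesis
    using laplace_expansion_row[OF assms, of 0]
    by (simp add: numeral_2_eq_2 cofactor_def)
qed

lemma jacobian_mat_carrier: "jacobian_mat D \<in> carrier_mat 2 2"
  unfolding jacobian_mat_def mat_of_rows_list_def carrier_mat_def by simp

lemma jacobian_mat_entries:
  "jacobian_mat D $$ (0, 0) = of_real (fst (D (1, 0)))"
  "jacobian_mat D $$ (0, 1) = of_real (fst (D (0, 1)))"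
  "jacobian_mat D $$ (1, 0) = of_real (snd (D (1, 0)))"
  "jacobian_mat D $$ (1, 1) = of_real (snd (D (0, 1)))"
  unfolding jacobian_mat_def mat_of_rows_list_def by (subst index_mat; auto)+

lemma eigenvalue_jacobian_mat:
  "eigenvalue (jacobian_mat D) l \<longleftrightarrow>
    l\<^sup>2 - of_real (fst (D (1, 0)) + snd (D (0, 1))) * l + of_real (jac_det D) = 0"
proof -
  note carrier = jacobian_mat_carrier[of D]
  have entries: "char_matrix (jacobian_mat D) l $$ (0, 0) = of_real (fst (D (1, 0))) - l"
    "char_matrix (jacobian_mat D) l $$ (0, 1) = of_real (fst (D (0, 1)))"
    "char_matrix (jacobian_mat D) l $$ (1, 0) = of_real (snd (D (1, 0)))"
    "char_matrix (jacobian_mat D) l $$ (1, 1) = of_real (snd (D (0, 1))) - l"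
    using carrier by (auto simp: char_matrix_def jacobian_mat_entries jacobian_mat_entries[simplified])
  have "Determinant.det (char_matrix (jacobian_mat D) l)
      = l\<^sup>2 - of_real (fst (D (1, 0)) + snd (D (0, 1))) * l + of_real (jac_det D)"
    unfolding det_mat_2_2[OF char_matrix_closed[OF carrier]] entries
    by (simp add: algebra_simps power2_eq_square)
  then show ?thesis unfolding eigenvalue_det[OF carrier] by simp
qed

lemma eigenvalue_jacobian_mat_vector:
  assumes "eigenvalue (jacobian_mat D) l"
  obtains u v where "(u, v) \<noteq> (0, 0)"
    "of_real (fst (D (1, 0))) * u + of_real (fst (D (0, 1))) * v = l * u"
    "of_real (snd (D (1, 0))) * u + of_real (snd (D (0, 1))) * v = l * v"
proof -
  note carrier = jacobian_mat_carrier[of D]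
  obtain x where x: "x \<in> carrier_vec 2" "x \<noteq> 0\<^sub>v 2" "jacobian_mat D *\<^sub>v x = l \<cdot>\<^sub>v x"
    using assms carrier by (auto simp: eigenvalue_def eigenvector_def)
  have "x = 0\<^sub>v 2" if "x $ 0 = 0" "x $ 1 = 0"
    using x(1) that by (intro eq_vecI) (auto simp: less_2_cases_iff)
  then have "(x $ 0, x $ 1) \<noteq> (0, 0)" using x(2) by auto
  moreover have "jacobian_mat D $$ (i, 0) * x $ 0 + jacobian_mat D $$ (i, 1) * x $ 1 = l * x $ i"
    if "i < 2" for i
  proof -
    have "(jacobian_mat D *\<^sub>v x) $ i = jacobian_mat D $$ (i, 0) * x $ 0 + jacobian_mat D $$ (i, 1) * x $ 1"
      using x(1) carrier that by (simp add: scalar_prod_def numeral_2_eq_2)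
    then show ?thesis using x that by simp
  qed
  from this[of 0] this[of 1] have
    "of_real (fst (D (1, 0))) * x $ 0 + of_real (fst (D (0, 1))) * x $ 1 = l * x $ 0"
    "of_real (snd (D (1, 0))) * x $ 0 + of_real (snd (D (0, 1))) * x $ 1 = l * x $ 1"
    by (simp_all add: jacobian_mat_entries[simplified])
  ultimately show ?thesis by (rule that)
qed

text \<open>The two roots of the characteristic polynomial have product \<open>1\<close>, so they lie on opposite sides of the
unit circle as soon as neither lies on it.\<close>

lemma saddle_if_no_unimodular:
  assumes "(g has_derivative D) (at p)" and det: "jac_det D = 1"
    and unim: "\<And>l. eigenvalue (jacobian_mat D) l \<Longrightarrow> cmod l \<noteq> 1"
  shows "saddle_deriv_at g p"
proof -
  define T :: complex where "T = of_real (fst (D (1, 0)) + snd (D (0, 1)))"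
  define l where "l = (T + csqrt (T\<^sup>2 - 4)) / 2"
  have root: "l\<^sup>2 - T * l + 1 = 0"
    by (simp add: l_def power2_eq_square field_simps) (simp flip: power2_eq_square)
  then have prod: "l * (T - l) = 1" by (simp add: power2_eq_square algebra_simps)
  have ev: "eigenvalue (jacobian_mat D) l" "eigenvalue (jacobian_mat D) (T - l)"
    using root unfolding eigenvalue_jacobian_mat T_def[symmetric] det
    by (simp_all add: power2_eq_square algebra_simps)
  have norms: "cmod l * cmod (T - l) = 1" using prod by (metis norm_mult norm_one)
  show ?thesis
  proof (cases "cmod l > 1")
    case True
    then have "cmod (T - l) < 1" using norms by (metis less_1_mult not_less_iff_gr_or_eq mult.right_neutral)
    then show ?thesis using True ev assms(1) unfolding saddle_deriv_at_def by blast
  next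
    case False
    then have "cmod l < 1" using unim[OF ev(1)] by simp
    moreover have "cmod (T - l) > 1"
      using norms \<open>cmod l < 1\<close> by (smt (verit) mult_left_le norm_ge_zero mult_nonneg_nonneg)
    ultimately show ?thesis using ev assms(1) unfolding saddle_deriv_at_def by blast
  qed
qed

section \<open>Periodic orbits\<close>

text \<open>The map translates the line \<open>y = x - 1\<close> by \<open>(a, a)\<close>, so no orbit on it returns.\<close>

lemma periodic_orbit_off_line:
  assumes "a \<noteq> 0" "0 < N" and per: "(fmap a ^^ N) q = q" and "\<And>i. fst ((fmap a ^^ i) q) \<noteq> 1"
  shows "snd q - fst q + 1 \<noteq> 0"
proof
  assume "snd q - fst q + 1 = 0"
  then have "fst ((fmap a ^^ N) q) = fst q + real N * a"
    using line_orbit[of a q N] assms(4) by simp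
  then show False using per assms(1,2) by simp
qed

text \<open>The values \<open>t k = - d\<close> and \<open>t k = d\<close> correspond to \<open>x = 1\<close> and \<open>x = - a\<close>. The first is the pole; the
second is excluded because \<open>f\<close> collapses \<open>x = - a\<close> to the point \<open>(0, - 1)\<close> of the translated line.\<close>

lemma periodic_orbit_centred_cycle:
  assumes a: "a < -1" and "0 < N" and per: "(fmap a ^^ N) p = p"
    and fin: "\<And>i. fst ((fmap a ^^ i) p) \<noteq> 1"
  shows "centred_cycle (\<lambda>k. snd ((fmap a ^^ k) p) + (1 - a) / 2) ((1 - a) / 2) (- (1 + a) / 2) N"
proof -
  define q where "q k = (fmap a ^^ k) p" for k
  have q_add: "(fmap a ^^ i) (q k) = q (k + i)" for i k
    by (simp add: q_def funpow_add add.commute[of k])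
  have cyc: "q (k + N) = q k" for k
    by (simp add: q_def funpow_add per)
  have Suc_q: "fst (q (Suc k)) = snd (q k) * ((fst (q k) + a) / (fst (q k) - 1))"
    "snd (q (Suc k)) = fst (q k) + a - 1" for k
    by (simp_all add: q_def fmap_def split_beta)
  have not_pole: "fst (q k) \<noteq> 1" for k using fin by (simp add: q_def)
  have off_line: "snd (q k) - fst (q k) + 1 \<noteq> 0" for k
    using a \<open>0 < N\<close> not_pole cyc
    by (intro periodic_orbit_off_line[of a N]) (auto simp: q_add)
  have not_crit: "fst (q k) \<noteq> - a" for k
  proof
    assume "fst (q k) = - a"
    then show False using off_line[of "Suc k"] by (simp add: Suc_q)
  qed
  have pred: "\<exists>j. q k = q (Suc j)" for k
    using cyc[of k] \<open>0 < N\<close> by (metis Suc_pred add_Suc_right)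
  have "centred_cycle (\<lambda>k. snd (q k) + (1 - a) / 2) ((1 - a) / 2) (- (1 + a) / 2) N"
  proof
    fix k
    show "snd (q (k + N)) + (1 - a) / 2 = snd (q k) + (1 - a) / 2" by (simp add: cyc)
    have "fst (q (Suc k)) * (fst (q k) - 1) = snd (q k) * (fst (q k) + a)"
      using not_pole[of k] by (simp add: Suc_q)
    then show "(snd (q (k + 2)) + (1 - a) / 2 + (1 - a) / 2) * (snd (q (k + 1)) + (1 - a) / 2 + - (1 + a) / 2)
      = (snd (q k) + (1 - a) / 2 - (1 - a) / 2) * (snd (q (k + 1)) + (1 - a) / 2 - - (1 + a) / 2)"
      by (simp add: Suc_q(2) numeral_2_eq_2 field_simps del: add_divide_distrib)
    obtain j where "q k = q (Suc j)" using pred by blast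
    then have *: "snd (q k) = fst (q j) + a - 1" by (simp add: Suc_q)
    show "snd (q k) + (1 - a) / 2 \<noteq> - (1 + a) / 2"
      using not_crit[of j] by (simp add: * field_simps)
    show "snd (q k) + (1 - a) / 2 \<noteq> - (- (1 + a) / 2)"
      using not_pole[of j] by (simp add: * field_simps)
  qed (use a \<open>0 < N\<close> in auto)
  then show ?thesis by (simp add: q_def)
qed

text \<open>An eigenvector for \<open>l\<close>, transported along the orbit, is a complex solution of the linearised recursion
that is multiplied by \<open>l\<close> in every period. The solution is read off from the second components of the
transported vector.\<close>

lemma no_unimodular_multiplier:
  assumes a: "a < -1" and "0 < N" and per: "(fmap a ^^ N) p = p"
    and fin: "\<And>i. fst ((fmap a ^^ i) p) \<noteq> 1"
    and ev: "eigenvalue (jacobian_mat (orbit_deriv a p N)) l"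
  shows "cmod l \<noteq> 1"
proof
  assume unim: "cmod l = 1"
  let ?D = "orbit_deriv a p"
  define t where "t k = snd ((fmap a ^^ k) p) + (1 - a) / 2" for k
  define m d where "m = (1 - a) / 2" and "d = - (1 + a) / 2"
  interpret centred_cycle t m d N
    unfolding t_def[abs_def] m_def d_def using periodic_orbit_centred_cycle[OF assms(1-4)] .
  obtain u v where uv: "(u, v) \<noteq> (0, 0)"
    "of_real (fst (?D N (1, 0))) * u + of_real (fst (?D N (0, 1))) * v = l * u"
    "of_real (snd (?D N (1, 0))) * u + of_real (snd (?D N (0, 1))) * v = l * v"
    using eigenvalue_jacobian_mat_vector[OF ev] .
  define \<xi> where "\<xi> k = of_real (snd (?D k (1, 0))) * u + of_real (snd (?D k (0, 1))) * v" for k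
  have \<xi>_Suc: "\<xi> (Suc k) = of_real (fst (?D k (1, 0))) * u + of_real (fst (?D k (0, 1))) * v" for k
    by (simp add: \<xi>_def fmap_deriv_def)
  have rec: "snd (?D (k + 2) w) = 2 * d * (t k - m) / (t (k + 1) + d)\<^sup>2 * snd (?D (k + 1) w)
      + (t (k + 1) - d) / (t (k + 1) + d) * snd (?D k w)" for k w
  proof -
    define q where "q = (fmap a ^^ k) p"
    have "t k - m = snd q" "t (k + 1) + d = fst q - 1" "t (k + 1) - d = fst q + a" "2 * d = - (1 + a)"
      by (simp_all add: t_def m_def d_def q_def fmap_def split_beta field_simps)
    then show ?thesis
      by (simp add: fmap_deriv_def numeral_2_eq_2 mult.commute flip: q_def)
  qed
  have var: "\<xi> (k + 2) = (2 * d * (t k - m) / (t (k + 1) + d)\<^sup>2) *\<^sub>R \<xi> (k + 1)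
      + ((t (k + 1) - d) / (t (k + 1) + d)) *\<^sub>R \<xi> k" for k
    unfolding \<xi>_def rec by (simp only: of_real_add of_real_mult scaleR_conv_of_real) (simp only: algebra_simps)
  have "\<xi> (k + N) = l * \<xi> k \<and> \<xi> (Suc k + N) = l * \<xi> (Suc k)" for k
  proof (induction k)
    case 0
    have "\<xi> 0 = v" "\<xi> (Suc 0) = u" by (simp_all add: \<xi>_def fmap_deriv_def)
    moreover have "\<xi> N = l * v" using uv(3) by (simp add: \<xi>_def)
    moreover have "\<xi> (Suc N) = l * u" using uv(2) by (simp add: \<xi>_Suc)
    ultimately show ?case by simp
  next
    case (Suc k)
    have "t (k + N) = t k" "t (k + N + 1) = t (k + 1)"
      using cyclic[of k] cyclic[of "k + 1"] by simp_all
    then have "\<xi> (k + 2 + N) = l * \<xi> (k + 2)"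
      using var[of "k + N"] var[of k] Suc by (simp add: algebra_simps)
    with Suc show ?case by simp
  qed
  then have "norm (\<xi> (k + N)) = norm (\<xi> k)" for k using unim by (simp add: norm_mult)
  then have "\<xi> k = 0" for k using norm_cyclic_variation_zero[OF var] by blast
  from this[of 0] this[of "Suc 0"] show False using uv(1) by (simp add: \<xi>_def fmap_deriv_def)
qed

theorem theorem6p4:
  fixes a :: real and p :: "real \<times> real" and n :: nat
  assumes "a < -1"
    and "n \<ge> 1"
    and "emb p \<notin> indet_iter a n"
    and "(fbar a ^^ n) (emb p) = emb p"
  shows "saddle_deriv_at (\<lambda>z. fin_part ((fbar a ^^ n) (emb z))) p"
proof -
  have n: "0 < n" using assms(2) by simp
  have fin_n: "fst ((fmap a ^^ i) p) \<noteq> 1" if "i < n" for i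
    using returning_orbit_finite[OF assms(1) _ that] assms(4) by simp
  have "emb ((fmap a ^^ n) p) = emb p" using fbar_iter_emb[OF fin_n] assms(4) by simp
  then have per: "(fmap a ^^ n) p = p" by (metis fin_part_emb)
  have fin: "fst ((fmap a ^^ i) p) \<noteq> 1" for i
  proof -
    have "(fmap a ^^ i) p = (fmap a ^^ (i mod n)) p" using funpow_mod_eq[OF per] by simp
    then show ?thesis using fin_n[of "i mod n"] n by simp
  qed
  have "snd p - fst p + 1 \<noteq> 0"
    using assms(1) n per fin by (intro periodic_orbit_off_line) auto
  then have "jac_det (orbit_deriv a p n) = 1"
    using jac_det_orbit_deriv[of n a p] fin per by simp
  then show ?thesis
    using fbar_iter_has_derivative[of n a p] fin no_unimodular_multiplier[OF assms(1) n per fin]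
    by (intro saddle_if_no_unimodular) auto
qed

end
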